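(* Let $X$ be a bounded lattice. In the ring $\mathbb{Z}^{\oplus X}$ (with product $x\cdot y=x\wedge y$ for $x,y\in X$) one has \[ J=\widetilde{J}+\langle 0_X\rangle, \] and consequently $\widetilde{V}(X)/\langle 0_X\rangle=M(X)$.
   Context: A bounded lattice $X$ has a least element $0_X$ and a greatest element $1_X$. $\mathbb{Z}^{\oplus X}$ is the free abelian group on the set $X$, made into a commutative ring with identity $1_X$ by extending $x\cdot y=x\wedge y$ bilinearly. $\widetilde{J}$ is the ideal of this ring generated by $\{x\vee y+x\wedge y-x-y : x,y\in X\}$, and $\widetilde{V}(X)=\mathbb{Z}^{\oplus X}/\widetilde{J}$. $J$ is the subgroup of $\mathbb{Z}^{\oplus X}$ generated (as an abelian group) by $0_X$ and all elements \[ x_1\vee\dots\vee x_k-\sum_{s=1}^k(-1)^{s+1}\sum_{1\leq i_1<\dots<i_s\leq k}x_{i_1}\wedge\dots\wedge x_{i_s},\qquad k\ge2,\ x_1,\dots,x_k\in X, \] and $M(X)=\mathbb{Z}^{\oplus X}/J$. $\langle 0_X\rangle$ denotes the ideal generated by the basis element $0_X$ (respectively by its class in $\widetilde{V}(X)$). *)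

theory Defs
  imports "HOL-Library.Poly_Mapping" "HOL-Algebra.QuotRing" "HOL-Algebra.Generated_Groups"
begin

text \<open>
  The bounded lattice \<open>X\<close> is a type of class \<open>bounded_lattice\<close>, with \<open>0\<^sub>X = Orderings.bot\<close> and
  \<open>1\<^sub>X = Orderings.top\<close>. No distributivity is assumed. The free abelian group on \<open>X\<close> is the type of finitely
  supported functions \<open>X \<Rightarrow>\<^sub>0 int\<close>, with basis elements \<open>frag_of x\<close>. The product below is the
  bilinear extension of the meet; the multiplication that \<open>Poly_Mapping\<close> itself defines on this
  type is a convolution with respect to addition of keys and plays no role here.
\<close>

definition meet_mult ::
    "('a::bounded_lattice \<Rightarrow>\<^sub>0 int) \<Rightarrow> ('a \<Rightarrow>\<^sub>0 int) \<Rightarrow> ('a \<Rightarrow>\<^sub>0 int)" where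
  "meet_mult f g = frag_extend (\<lambda>x. frag_extend (\<lambda>y. frag_of (Lattices.inf x y)) g) f"

definition lat_ring :: "('a::bounded_lattice \<Rightarrow>\<^sub>0 int) ring" where
  "lat_ring = \<lparr>carrier = UNIV, mult = meet_mult, one = frag_of Orderings.top, zero = 0, add = (+)\<rparr>"

lemma meet_mult_frag_of: "meet_mult (frag_of x) (frag_of y) = frag_of (Lattices.inf x y)"
  by (simp add: meet_mult_def)

lemma meet_mult_0_left: "meet_mult 0 g = 0"
  by (simp add: meet_mult_def)

lemma meet_mult_0_right: "meet_mult f 0 = 0"
  by (simp add: meet_mult_def frag_extend_eq_0)

lemma meet_mult_diff_left: "meet_mult (f - g) h = meet_mult f h - meet_mult g h"
  by (simp add: meet_mult_def frag_extend_diff)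

lemma frag_cmul_diff_right: "frag_cmul c (f - g) = frag_cmul c f - frag_cmul c g"
  by (rule poly_mapping_eqI) (simp add: lookup_minus algebra_simps)

lemma meet_mult_diff_right: "meet_mult h (f - g) = meet_mult h f - meet_mult h g"
  by (simp add: meet_mult_def frag_extend_diff)
    (simp add: frag_extend_def[of _ h] frag_cmul_diff_right sum_subtractf)

lemma meet_mult_add_left: "meet_mult (f + g) h = meet_mult f h + meet_mult g h"
  by (simp add: meet_mult_def frag_extend_add)

lemma frag_induct [case_names zero of diff]:
  assumes "P 0" "\<And>x. P (frag_of x)" "\<And>f g. P f \<Longrightarrow> P g \<Longrightarrow> P (f - g)"
  shows "P f"
  using frag_induction[of f UNIV P] assms by auto

lemmas meet_mult_linear =
  meet_mult_0_left meet_mult_0_right meet_mult_diff_left meet_mult_diff_right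

lemma meet_mult_commute: "meet_mult f g = meet_mult g f"
proof (induction f rule: frag_induct)
  case (of x)
  show ?case
    by (induction g rule: frag_induct)
      (simp_all add: meet_mult_linear meet_mult_frag_of Lattices.inf_commute)
qed (simp_all add: meet_mult_linear)

lemma meet_mult_assoc: "meet_mult (meet_mult f g) h = meet_mult f (meet_mult g h)"
proof (induction f rule: frag_induct)
  case (of x)
  show ?case
  proof (induction g rule: frag_induct)
    case (of y)
    show ?case
      by (induction h rule: frag_induct)
        (simp_all add: meet_mult_linear meet_mult_frag_of Lattices.inf_assoc)
  qed (simp_all add: meet_mult_linear)
qed (simp_all add: meet_mult_linear)

lemma meet_mult_top: "meet_mult (frag_of Orderings.top) f = f"
  by (induction f rule: frag_induct) (simp_all add: meet_mult_linear meet_mult_frag_of)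

lemma cring_lat_ring: "cring (lat_ring :: ('a::bounded_lattice \<Rightarrow>\<^sub>0 int) ring)"
proof (rule cringI)
  show "abelian_group (lat_ring :: ('a \<Rightarrow>\<^sub>0 int) ring)"
  proof (rule abelian_groupI)
    fix f :: "'a \<Rightarrow>\<^sub>0 int"
    show "\<exists>g\<in>carrier lat_ring. g \<oplus>\<^bsub>lat_ring\<^esub> f = \<zero>\<^bsub>lat_ring\<^esub>"
      by (rule bexI[of _ "- f"]) (simp_all add: lat_ring_def)
  qed (simp_all add: lat_ring_def ac_simps)
  show "comm_monoid (lat_ring :: ('a \<Rightarrow>\<^sub>0 int) ring)"
    by (rule comm_monoidI)
      (simp_all add: lat_ring_def meet_mult_assoc meet_mult_top,
        rule meet_mult_commute)
qed (simp_all add: lat_ring_def meet_mult_add_left)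

definition Jtilde :: "('a::bounded_lattice \<Rightarrow>\<^sub>0 int) set" where
  "Jtilde = genideal lat_ring
     {frag_of (Lattices.sup x y) + frag_of (Lattices.inf x y) - frag_of x - frag_of y | x y. True}"

definition Vtilde :: "('a::bounded_lattice \<Rightarrow>\<^sub>0 int) set ring" where
  "Vtilde = lat_ring Quot Jtilde"

text \<open>Index tuples \<open>1 \<le> i\<^sub>1 < \<dots> < i\<^sub>s \<le> k\<close> are encoded as \<open>s\<close>-element subsets of \<open>{1..k}\<close>.\<close>

definition incl_excl :: "nat \<Rightarrow> (nat \<Rightarrow> 'a::bounded_lattice) \<Rightarrow> ('a \<Rightarrow>\<^sub>0 int)" where
  "incl_excl k x =
     frag_of (Sup_fin (x ` {1..k})) -
     (\<Sum>s = 1..k. frag_cmul ((-1) ^ (s + 1))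
        (\<Sum>I \<in> {I. I \<subseteq> {1..k} \<and> card I = s}. frag_of (Inf_fin (x ` I))))"

definition Jsub :: "('a::bounded_lattice \<Rightarrow>\<^sub>0 int) set" where
  "Jsub = generate (add_monoid lat_ring)
     (insert (frag_of Orderings.bot) {incl_excl k x | k x. k \<ge> 2})"

definition Mgroup :: "('a::bounded_lattice \<Rightarrow>\<^sub>0 int) set monoid" where
  "Mgroup = lat_ring A_Mod Jsub"

text \<open>The ideal of the quotient ring \<open>Vtilde\<close> generated by the class of \<open>0\<^sub>X\<close>.\<close>

definition Vtilde_bot :: "('a::bounded_lattice \<Rightarrow>\<^sub>0 int) set set" where
  "Vtilde_bot = genideal Vtilde {Jtilde +>\<^bsub>lat_ring\<^esub> frag_of Orderings.bot}"

end

theory Submission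
  imports Defs
begin

text \<open>
  Expanding \<open>\<Prod>(1 - x\<^sub>i)\<close> gives the alternating sum over meets, so the inclusion-exclusion element of
  \<open>x\<^sub>1, \<dots>, x\<^sub>k\<close> is \<open>D\<^sub>k = \<Prod>(1 - x\<^sub>i) - (1 - x\<^sub>1 \<or> \<dots> \<or> x\<^sub>k)\<close>. Multiplying by \<open>1 - x\<^sub>k\<^sub>+\<^sub>1\<close> yields
  \<open>D\<^sub>k\<^sub>+\<^sub>1 = r(x\<^sub>1 \<or> \<dots> \<or> x\<^sub>k, x\<^sub>k\<^sub>+\<^sub>1) + D\<^sub>k - x\<^sub>k\<^sub>+\<^sub>1 \<cdot> D\<^sub>k\<close>, where \<open>r(x, y) = x \<or> y + x \<and> y - x - y\<close>.
  Read from left to right this puts every \<open>D\<^sub>k\<close> into the ideal generated by the \<open>r(x, y)\<close>. Solved for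
  \<open>x\<^sub>k\<^sub>+\<^sub>1 \<cdot> D\<^sub>k\<close>, with \<open>x\<^sub>k\<^sub>+\<^sub>1\<close> arbitrary, it shows that the subgroup generated by the \<open>D\<^sub>k\<close> is
  closed under multiplication by the basis, even though the lattice need not be distributive.
\<close>

section \<open>Quotients of quotient rings\<close>

lemma carrier_Quot: "carrier (R Quot I) = (\<lambda>x. I +>\<^bsub>R\<^esub> x) ` carrier R"
  by (auto simp: FactRing_def A_RCOSETS_def')

lemma add_monoid_Quot: "add_monoid (R Quot I) = R A_Mod I"
  by (simp add: FactRing_def A_FactGroup_def')

lemma ring_iso_imp_add_iso:
  assumes "h \<in> ring_iso R S"
  shows "h \<in> iso (add_monoid R) (add_monoid S)"
  using assms by (auto simp: ring_iso_def ring_hom_def iso_def hom_def)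

lemma (in ring_hom_ring) surj_image_ideal:
  assumes surj: "h ` carrier R = carrier S" and I: "ideal I R"
  shows "ideal (h ` I) S"
proof (rule idealI[OF S.ring_axioms])
  interpret I: ideal I R by (rule I)
  show "subgroup (h ` I) (add_monoid S)"
    by (rule img_is_add_subgroup[OF I.a_subgroup])
  fix a s assume "a \<in> h ` I" "s \<in> carrier S"
  then obtain i r where i: "i \<in> I" "a = h i" and r: "r \<in> carrier R" "s = h r"
    using surj by blast
  then have "s \<otimes>\<^bsub>S\<^esub> a = h (r \<otimes> i)" "a \<otimes>\<^bsub>S\<^esub> s = h (i \<otimes> r)"
    using I.Icarr by simp_all
  then show "s \<otimes>\<^bsub>S\<^esub> a \<in> h ` I" "a \<otimes>\<^bsub>S\<^esub> s \<in> h ` I"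
    using I.I_l_closed I.I_r_closed i(1) r(1) by blast+
qed

lemma (in ring_hom_ring) surj_image_genideal:
  assumes surj: "h ` carrier R = carrier S" and A: "A \<subseteq> carrier R"
  shows "h ` genideal R A = genideal S (h ` A)"
proof
  have hA: "h ` A \<subseteq> carrier S"
    using A surj by blast
  have "ideal {r \<in> carrier R. h r \<in> genideal S (h ` A)} R"
    by (rule ideal_vimage[OF S.genideal_ideal[OF hA]])
  then have "genideal R A \<subseteq> {r \<in> carrier R. h r \<in> genideal S (h ` A)}"
    by (rule R.genideal_minimal) (use A S.genideal_self[OF hA] in blast)
  then show "h ` genideal R A \<subseteq> genideal S (h ` A)"
    by blast
  show "genideal S (h ` A) \<subseteq> h ` genideal R A"
    by (rule S.genideal_minimal[OF surj_image_ideal[OF surj R.genideal_ideal[OF A]]])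
      (rule image_mono[OF R.genideal_self[OF A]])
qed

lemma (in ideal) image_a_rcos_set_add:
  assumes "J \<subseteq> carrier R"
  shows "(+>) I ` (I <+> J) = (+>) I ` J"
proof -
  have absorb: "I +> (i \<oplus> j) = I +> j" if "i \<in> I" "j \<in> J" for i j
    using that assms a_coset_add_assoc[of I i j] by (auto simp: a_subset a_rcos_const)
  have "(+>) I ` (I <+> J) = (\<Union>i\<in>I. \<Union>j\<in>J. {I +> (i \<oplus> j)})"
    by (simp add: set_add_def' image_UN)
  also have "\<dots> = (\<Union>i\<in>I. \<Union>j\<in>J. {I +> j})"
    by (simp add: absorb)
  also have "\<dots> = (+>) I ` J"
    using additive_subgroup.zero_closed[OF is_additive_subgroup] by blast
  finally show ?thesis .
qed

lemma (in ideal) rcos_image_a_rcos: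
  assumes "K \<subseteq> carrier R" "x \<in> carrier R"
  shows "(+>) I ` K +>\<^bsub>R Quot I\<^esub> (I +> x) = (+>) I ` (K +> x)"
  by (rule a_coset_hom(2)[OF rcos_ring_hom assms, symmetric])

lemma (in ideal) Union_image_a_rcos:
  assumes K: "ideal K R" and "I \<subseteq> K" and x: "x \<in> carrier R"
  shows "\<Union> ((+>) I ` (K +> x)) = K +> x"
proof -
  interpret K: ideal K R by (rule K)
  have "\<Union> ((+>) I ` (K +> x)) = I <+> (K +> x)"
    by (auto simp: set_add_def' a_r_coset_def')
  also have "\<dots> = (I <+> K) +> x"
    by (rule a_setmult_rcos_assoc[OF a_subset K.a_subset x])
  also have "I <+> K = (\<Union>k\<in>K. I +> k)"
    by (auto simp: set_add_def' a_r_coset_def')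
  also have "\<dots> = K"
    using ideal_incl_iff[OF is_ideal K] \<open>I \<subseteq> K\<close> by simp
  finally show ?thesis .
qed

lemma (in ideal) image_rcos_ring_hom_ring:
  assumes K: "ideal K R"
  shows "ring_hom_ring R ((R Quot I) Quot ((+>) I ` K)) (\<lambda>x. (+>) I ` (K +> x))"
proof -
  interpret K: ideal K R by (rule K)
  interpret L: ideal "(+>) I ` K" "R Quot I"
    by (rule ring_ideal_imp_quot_ideal[OF is_ideal K])
  have "(\<lambda>x. (+>) I ` K +>\<^bsub>R Quot I\<^esub> (I +> x)) \<in> ring_hom R ((R Quot I) Quot ((+>) I ` K))"
    using ring_hom_trans[OF rcos_ring_hom L.rcos_ring_hom] by (simp add: comp_def)
  then have "(\<lambda>x. (+>) I ` (K +> x)) \<in> ring_hom R ((R Quot I) Quot ((+>) I ` K))"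
    by (rule ring_hom_restrict) (rule rcos_image_a_rcos[OF K.a_subset])
  then show ?thesis
    by (rule ring_hom_ringI2[OF ring_axioms L.quotient_is_ring])
qed

lemma (in ideal) carrier_Quot_Quot:
  assumes "K \<subseteq> carrier R"
  shows "carrier ((R Quot I) Quot ((+>) I ` K)) = (\<lambda>x. (+>) I ` (K +> x)) ` carrier R"
  unfolding carrier_Quot image_image by (rule image_cong[OF refl rcos_image_a_rcos[OF assms]])

lemma (in ideal) bij_betw_Union_Quot:
  assumes K: "ideal K R" and "I \<subseteq> K"
  shows "bij_betw \<Union> (carrier ((R Quot I) Quot ((+>) I ` K))) (carrier (R Quot K))"
proof -
  interpret K: ideal K R by (rule K)
  show ?thesis
    unfolding carrier_Quot_Quot[OF K.a_subset] carrier_Quot[of R K]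
    by (rule bij_betw_byWitness[where f' = "\<lambda>X. (+>) I ` X"])
      (simp_all add: image_image Union_image_a_rcos[OF assms] cong: image_cong_simp)
qed

theorem (in ideal) Union_quot_quot_ring_iso:
  assumes K: "ideal K R" and "I \<subseteq> K"
  shows "\<Union> \<in> ring_iso ((R Quot I) Quot ((+>) I ` K)) (R Quot K)"
proof -
  let ?Q = "(R Quot I) Quot ((+>) I ` K)"
  define p where "p = (\<lambda>x. (+>) I ` (K +> x))"
  interpret K: ideal K R by (rule K)
  interpret p: ring_hom_ring R ?Q p
    unfolding p_def by (rule image_rcos_ring_hom_ring[OF K])
  interpret q: ring_hom_ring R "R Quot K" "(+>) K" by (rule K.rcos_ring_hom_ring)
  have Union_p: "\<Union> (p x) = K +> x" if "x \<in> carrier R" for x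
    unfolding p_def by (rule Union_image_a_rcos[OF assms that])
  have surj: "carrier ?Q = p ` carrier R"
    unfolding p_def by (rule carrier_Quot_Quot[OF K.a_subset])
  show ?thesis
  proof (rule ring_iso_memI)
    show "bij_betw \<Union> (carrier ?Q) (carrier (R Quot K))"
      by (rule bij_betw_Union_Quot[OF assms])
    show "\<Union> \<one>\<^bsub>?Q\<^esub> = \<one>\<^bsub>R Quot K\<^esub>"
      using Union_p[OF one_closed] by simp
  next
    fix X Y assume "X \<in> carrier ?Q" "Y \<in> carrier ?Q"
    then obtain x y where "x \<in> carrier R" "X = p x" "y \<in> carrier R" "Y = p y"
      unfolding surj by blast
    then show "\<Union> X \<in> carrier (R Quot K)"
      "\<Union> (X \<otimes>\<^bsub>?Q\<^esub> Y) = \<Union> X \<otimes>\<^bsub>R Quot K\<^esub> \<Union> Y"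
      "\<Union> (X \<oplus>\<^bsub>?Q\<^esub> Y) = \<Union> X \<oplus>\<^bsub>R Quot K\<^esub> \<Union> Y"
      by (simp_all add: Union_p flip: p.hom_mult p.hom_add)
  qed
qed

lemma (in ideal) genideal_image_a_rcos:
  assumes A: "A \<subseteq> carrier R"
  shows "genideal (R Quot I) ((+>) I ` A) = (+>) I ` (I <+> genideal R A)"
proof -
  interpret A: ideal "genideal R A" R
    by (rule genideal_ideal[OF A])
  have "genideal (R Quot I) ((+>) I ` A) = (+>) I ` genideal R A"
    by (rule ring_hom_ring.surj_image_genideal[OF rcos_ring_hom_ring carrier_Quot[symmetric] A,
          symmetric])
  also have "\<dots> = (+>) I ` (I <+> genideal R A)"
    by (rule image_a_rcos_set_add[OF A.a_subset, symmetric])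
  finally show ?thesis .
qed

section \<open>Additive subgroups that are ideals\<close>

lemma (in ring) subgroup_vimage_mult:
  assumes H: "subgroup H (add_monoid R)" and r: "r \<in> carrier R"
  shows "subgroup {s \<in> carrier R. r \<otimes> s \<in> H} (add_monoid R)"
proof -
  interpret H: additive_subgroup H R by (rule additive_subgroupI[OF H])
  show ?thesis
    by (rule add.subgroupI) (use r in \<open>auto simp: r_distr r_minus simp flip: a_inv_def\<close>)
qed

lemma (in cring) ideal_generateI:
  assumes span: "generate (add_monoid R) B = carrier R"
    and A: "A \<subseteq> carrier R" and B: "B \<subseteq> carrier R"
    and mult: "\<And>b a. b \<in> B \<Longrightarrow> a \<in> A \<Longrightarrow> b \<otimes> a \<in> generate (add_monoid R) A"
  shows "ideal (generate (add_monoid R) A) R"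
proof -
  let ?H = "generate (add_monoid R) A"
  have H: "subgroup ?H (add_monoid R)"
    using A by (intro add.generate_is_subgroup) simp
  have basis: "b \<otimes> h \<in> ?H" if "b \<in> B" "h \<in> ?H" for b h
  proof -
    have "?H \<subseteq> {s \<in> carrier R. b \<otimes> s \<in> ?H}"
      using that(1) A B mult by (intro add.generate_subgroup_incl subgroup_vimage_mult[OF H]) auto
    with that(2) show ?thesis by blast
  qed
  have closed: "h \<otimes> r \<in> ?H" if "h \<in> ?H" "r \<in> carrier R" for h r
  proof -
    have h: "h \<in> carrier R"
      using subgroup.subset[OF H] that(1) by auto
    then have "generate (add_monoid R) B \<subseteq> {s \<in> carrier R. h \<otimes> s \<in> ?H}"
      using B basis[OF _ that(1)] m_comm[OF h]
      by (intro add.generate_subgroup_incl subgroup_vimage_mult[OF H]) auto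
    with that(2) span show ?thesis by blast
  qed
  show ?thesis
  proof (rule idealI[OF ring_axioms H])
    fix h r assume "h \<in> ?H" "r \<in> carrier R"
    then show "h \<otimes> r \<in> ?H" "r \<otimes> h \<in> ?H"
      using closed m_comm[of r h] subgroup.subset[OF H] by auto
  qed
qed

section \<open>Inclusion-exclusion in the meet ring\<close>

lemma lat_ring_simps [simp]:
  "carrier lat_ring = UNIV" "mult lat_ring = meet_mult" "\<one>\<^bsub>lat_ring\<^esub> = frag_of Orderings.top"
  "\<zero>\<^bsub>lat_ring\<^esub> = 0" "add lat_ring = (+)"
  by (simp_all add: lat_ring_def)

interpretation lat_ring: cring lat_ring
  by (rule cring_lat_ring)

lemma additive_subgroup_lat_ringD:
  assumes "additive_subgroup H lat_ring"
  shows "0 \<in> H" and "f \<in> H \<Longrightarrow> g \<in> H \<Longrightarrow> f + g \<in> H" and "f \<in> H \<Longrightarrow> g \<in> H \<Longrightarrow> f - g \<in> H"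
proof -
  interpret H: additive_subgroup H lat_ring by (rule assms)
  have minus: "\<ominus>\<^bsub>lat_ring\<^esub> g = - g" for g :: "'a \<Rightarrow>\<^sub>0 int"
    by (rule lat_ring.minus_equality) simp_all
  show "0 \<in> H" and add: "f \<in> H \<Longrightarrow> g \<in> H \<Longrightarrow> f + g \<in> H" for f g
    using H.zero_closed H.a_closed[of f g] by simp_all
  show "f - g \<in> H" if "f \<in> H" "g \<in> H"
    using add[of f "- g"] H.a_inv_closed[of g] that by (simp add: minus)
qed

lemma generate_range_frag_of: "generate (add_monoid lat_ring) (range frag_of) = UNIV"
proof -
  have "subgroup (generate (add_monoid lat_ring) (range frag_of)) (add_monoid lat_ring)"
    by (rule lat_ring.add.generate_is_subgroup) simp
  note closed = additive_subgroup_lat_ringD[OF additive_subgroupI[OF this]]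
  have "f \<in> generate (add_monoid lat_ring) (range frag_of)" for f :: "'a \<Rightarrow>\<^sub>0 int"
  proof (induction f rule: frag_induct)
    case (of x)
    show ?case by (rule generate.incl) (rule rangeI)
  qed (rule closed; assumption)+
  then show ?thesis by blast
qed

lemma meet_mult_add_right: "meet_mult h (f + g) = meet_mult h f + meet_mult h g"
  using lat_ring.r_distr[of f g h] by simp

lemma meet_mult_sum_right: "meet_mult h (\<Sum>i\<in>A. f i) = (\<Sum>i\<in>A. meet_mult h (f i))"
  by (induction A rule: infinite_finite_induct)
    (simp_all add: meet_mult_0_right meet_mult_add_right)

lemma meet_mult_cmul_right: "meet_mult h (frag_cmul c f) = frag_cmul c (meet_mult h f)"
  unfolding meet_mult_commute[of h] by (simp add: meet_mult_def frag_extend_cmul)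

text \<open>
  The expansion of \<open>\<Prod>i\<in>A. (1 - x i)\<close>. Adjoining \<open>top\<close> gives the empty meet its value \<open>1\<^sub>X\<close>; on \<open>{}\<close>
  alone \<open>Inf_fin\<close> is unspecified.
\<close>

definition meet_expansion :: "'i set \<Rightarrow> ('i \<Rightarrow> 'a::bounded_lattice) \<Rightarrow> ('a \<Rightarrow>\<^sub>0 int)" where
  "meet_expansion A x =
     (\<Sum>I\<in>Pow A. frag_cmul ((-1) ^ card I) (frag_of (Inf_fin (insert Orderings.top (x ` I)))))"

lemma meet_expansion_empty: "meet_expansion {} x = frag_of Orderings.top"
  by (simp add: meet_expansion_def)

lemma meet_expansion_insert:
  assumes A: "finite A" "a \<notin> A"
  shows "meet_expansion (insert a A) x =
    meet_expansion A x - meet_mult (frag_of (x a)) (meet_expansion A x)"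
proof -
  let ?m = "\<lambda>I. Inf_fin (insert Orderings.top (x ` I))"
  let ?t = "\<lambda>I. frag_cmul ((-1) ^ card I) (frag_of (?m I))"
  have "meet_expansion (insert a A) x = meet_expansion A x + (\<Sum>I\<in>insert a ` Pow A. ?t I)"
    unfolding meet_expansion_def Pow_insert using A by (intro sum.union_disjoint) auto
  also have "(\<Sum>I\<in>insert a ` Pow A. ?t I) = (\<Sum>I\<in>Pow A. ?t (insert a I))"
    using A(2) by (subst sum.reindex) (auto simp: inj_on_def)
  also have "\<dots> = (\<Sum>I\<in>Pow A. - meet_mult (frag_of (x a)) (?t I))"
  proof (rule sum.cong[OF refl])
    fix I assume "I \<in> Pow A"
    then have I: "finite I" "a \<notin> I"
      using A by (auto intro: finite_subset)
    then have "?m (insert a I) = Lattices.inf (x a) (?m I)"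
      by (simp add: insert_commute[of Orderings.top])
    with I show "?t (insert a I) = - meet_mult (frag_of (x a)) (?t I)"
      by (simp add: meet_mult_cmul_right meet_mult_frag_of)
  qed
  also have "\<dots> = - meet_mult (frag_of (x a)) (meet_expansion A x)"
    unfolding meet_expansion_def meet_mult_sum_right sum_negf ..
  finally show ?thesis by simp
qed

lemma sum_nonempty_subsets_by_card:
  assumes A: "finite A"
  shows "(\<Sum>s = 1..card A. \<Sum>I\<in>{I. I \<subseteq> A \<and> card I = s}. g I) = (\<Sum>I\<in>Pow A - {{}}. g I)"
proof -
  have "(\<Sum>s = 1..card A. \<Sum>I\<in>{I. I \<subseteq> A \<and> card I = s}. g I) =
      (\<Sum>s = 1..card A. \<Sum>I\<in>{I \<in> Pow A - {{}}. card I = s}. g I)"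
    by (intro sum.cong) auto
  also have "\<dots> = (\<Sum>I\<in>Pow A - {{}}. g I)"
  proof (rule sum.group)
    show "card ` (Pow A - {{}}) \<subseteq> {1..card A}"
      using A by (auto simp: Suc_le_eq card_gt_0_iff card_mono dest: finite_subset)
  qed (use A in auto)
  finally show ?thesis .
qed

lemma incl_excl_conv_meet_expansion:
  "incl_excl k x =
    meet_expansion {1..k} x - (frag_of Orderings.top - frag_of (Sup_fin (x ` {1..k})))"
proof -
  let ?t = "\<lambda>I. frag_cmul ((-1) ^ card I) (frag_of (Inf_fin (insert Orderings.top (x ` I))))"
  have summand: "frag_cmul ((-1) ^ (s + 1)) (frag_of (Inf_fin (x ` I))) = - ?t I"
    if "s \<in> {1..k}" "I \<subseteq> {1..k}" "card I = s" for s I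
  proof -
    have "finite I" "I \<noteq> {}"
      using that by (auto intro: finite_subset)
    then show ?thesis
      using that(3) by simp
  qed
  have "(\<Sum>s = 1..k. frag_cmul ((-1) ^ (s + 1))
          (\<Sum>I \<in> {I. I \<subseteq> {1..k} \<and> card I = s}. frag_of (Inf_fin (x ` I)))) =
        (\<Sum>s = 1..k. \<Sum>I \<in> {I. I \<subseteq> {1..k} \<and> card I = s}. - ?t I)"
    unfolding frag_cmul_sum by (intro sum.cong refl summand) auto
  also have "\<dots> = (\<Sum>I\<in>Pow {1..k} - {{}}. - ?t I)"
    using sum_nonempty_subsets_by_card[of "{1..k}" "\<lambda>I. - ?t I"] by simp
  also have "\<dots> = frag_of Orderings.top - meet_expansion {1..k} x"
    unfolding meet_expansion_def sum_negf by (simp add: sum_diff1)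
  finally show ?thesis
    unfolding incl_excl_def by simp
qed

definition modular_rel :: "'a::bounded_lattice \<Rightarrow> 'a \<Rightarrow> ('a \<Rightarrow>\<^sub>0 int)" where
  "modular_rel x y =
     frag_of (Lattices.sup x y) + frag_of (Lattices.inf x y) - frag_of x - frag_of y"

lemma incl_excl_Suc:
  assumes "k \<ge> 1"
  shows "incl_excl (Suc k) x =
    modular_rel (Sup_fin (x ` {1..k})) (x (Suc k)) + incl_excl k x
      - meet_mult (frag_of (x (Suc k))) (incl_excl k x)"
proof -
  have "Sup_fin (x ` {1..Suc k}) = Lattices.sup (x (Suc k)) (Sup_fin (x ` {1..k}))"
    using assms by (simp add: atLeastAtMostSuc_conv)
  moreover have "meet_expansion {1..Suc k} x =
      meet_expansion {1..k} x - meet_mult (frag_of (x (Suc k))) (meet_expansion {1..k} x)"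
    by (simp add: atLeastAtMostSuc_conv meet_expansion_insert)
  ultimately show ?thesis
    by (simp add: incl_excl_conv_meet_expansion modular_rel_def
        meet_mult_add_right meet_mult_diff_right meet_mult_frag_of
        Lattices.sup_commute Lattices.inf_commute algebra_simps)
qed

lemma incl_excl_1: "incl_excl (Suc 0) x = 0"
  by (simp add: incl_excl_conv_meet_expansion meet_expansion_insert meet_expansion_empty
      meet_mult_frag_of)

lemma incl_excl_2: "incl_excl 2 x = modular_rel (x 1) (x 2)"
  using incl_excl_Suc[of 1 x] by (simp add: incl_excl_1 meet_mult_0_right numeral_2_eq_2)

lemma incl_excl_cong:
  assumes "\<And>i. i \<in> {1..k} \<Longrightarrow> x i = y i"
  shows "incl_excl k x = incl_excl k y"
proof -
  have "x ` I = y ` I" if "I \<subseteq> {1..k}" for I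
    using assms that by (intro image_cong) auto
  then show ?thesis
    unfolding incl_excl_def by simp
qed

section \<open>Comparison of the two ideals\<close>

lemma additive_subgroup_Jsub: "additive_subgroup Jsub lat_ring"
  unfolding Jsub_def by (intro additive_subgroupI lat_ring.add.generate_is_subgroup) simp

lemmas Jsub_closed = additive_subgroup_lat_ringD[OF additive_subgroup_Jsub]

lemma bot_in_Jsub: "frag_of Orderings.bot \<in> Jsub"
  unfolding Jsub_def by (rule generate.incl) simp

lemma incl_excl_in_Jsub: "k \<ge> 2 \<Longrightarrow> incl_excl k x \<in> Jsub"
  unfolding Jsub_def by (rule generate.incl) blast

lemma modular_rel_in_Jsub: "modular_rel x y \<in> Jsub"
  using incl_excl_in_Jsub[of 2 "\<lambda>i. if i = 1 then x else y"] by (simp add: incl_excl_2)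

lemma meet_mult_incl_excl_in_Jsub:
  assumes "k \<ge> 2"
  shows "meet_mult (frag_of a) (incl_excl k x) \<in> Jsub"
proof -
  define y where "y = x(Suc k := a)"
  have "incl_excl k x = incl_excl k y"
    by (rule incl_excl_cong) (auto simp: y_def)
  moreover have "meet_mult (frag_of a) (incl_excl k y) =
      modular_rel (Sup_fin (y ` {1..k})) (y (Suc k)) + incl_excl k y - incl_excl (Suc k) y"
    using incl_excl_Suc[of k y] assms by (simp add: y_def)
  moreover have "\<dots> \<in> Jsub"
    using assms by (intro Jsub_closed modular_rel_in_Jsub incl_excl_in_Jsub) simp_all
  ultimately show ?thesis by simp
qed

lemma ideal_Jsub: "ideal Jsub lat_ring"
  unfolding Jsub_def
proof (rule lat_ring.ideal_generateI)
  show "generate (add_monoid lat_ring) (range frag_of) = carrier lat_ring"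
    unfolding generate_range_frag_of by simp
  fix b g :: "'a \<Rightarrow>\<^sub>0 int"
  assume "b \<in> range frag_of" "g \<in> insert (frag_of Orderings.bot) {incl_excl k x | k x. k \<ge> 2}"
  then have "meet_mult b g \<in> Jsub"
    using bot_in_Jsub meet_mult_incl_excl_in_Jsub by (auto simp: meet_mult_frag_of)
  then show "b \<otimes>\<^bsub>lat_ring\<^esub> g \<in> generate (add_monoid lat_ring)
      (insert (frag_of Orderings.bot) {incl_excl k x | k x. k \<ge> 2})"
    by (simp add: Jsub_def)
qed simp_all

lemma ideal_Jtilde: "ideal Jtilde lat_ring"
  unfolding Jtilde_def by (rule lat_ring.genideal_ideal) simp

lemmas Jtilde_closed = additive_subgroup_lat_ringD[OF ideal.axioms(1)[OF ideal_Jtilde]]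

lemma modular_rel_in_Jtilde: "modular_rel x y \<in> Jtilde"
  unfolding Jtilde_def modular_rel_def by (rule subsetD[OF lat_ring.genideal_self]) auto

lemma incl_excl_in_Jtilde:
  assumes "k \<ge> 1"
  shows "incl_excl k x \<in> Jtilde"
  using assms
proof (induction k rule: dec_induct)
  case base
  show ?case
    by (simp add: incl_excl_1 Jtilde_closed(1))
next
  case (step k)
  have "meet_mult (frag_of (x (Suc k))) (incl_excl k x) \<in> Jtilde"
    using ideal.I_l_closed[OF ideal_Jtilde step.IH] by simp
  then show ?case
    unfolding incl_excl_Suc[OF step.hyps(1)]
    by (intro Jtilde_closed modular_rel_in_Jtilde step.IH)
qed

lemma Jtilde_subset_Jsub: "Jtilde \<subseteq> Jsub"
  unfolding Jtilde_def
  by (rule lat_ring.genideal_minimal[OF ideal_Jsub])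
    (use modular_rel_in_Jsub in \<open>auto simp: modular_rel_def\<close>)

theorem Jsub_eq_Jtilde_add_genideal_bot:
  "Jsub = Jtilde <+>\<^bsub>lat_ring\<^esub> genideal lat_ring {frag_of Orderings.bot}"
proof -
  let ?B = "genideal lat_ring {frag_of Orderings.bot}"
  have "Jsub = genideal lat_ring (Jtilde \<union> ?B)"
  proof
    have "frag_of Orderings.bot \<in> ?B"
      by (rule lat_ring.genideal_self') simp
    then have "insert (frag_of Orderings.bot) {incl_excl k x | k x. k \<ge> 2} \<subseteq> Jtilde \<union> ?B"
      using incl_excl_in_Jtilde[OF order_trans[OF one_le_numeral]] by blast
    also have "\<dots> \<subseteq> genideal lat_ring (Jtilde \<union> ?B)"
      by (rule lat_ring.genideal_self) simp
    finally show "Jsub \<subseteq> genideal lat_ring (Jtilde \<union> ?B)"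
      unfolding Jsub_def
      by (rule lat_ring.add.generate_subgroup_incl)
        (intro additive_subgroup.a_subgroup ideal.axioms(1) lat_ring.genideal_ideal, simp)
  next
    have "?B \<subseteq> Jsub"
      by (rule lat_ring.genideal_minimal[OF ideal_Jsub]) (simp add: bot_in_Jsub)
    with Jtilde_subset_Jsub have "Jtilde \<union> ?B \<subseteq> Jsub"
      by simp
    then show "genideal lat_ring (Jtilde \<union> ?B) \<subseteq> Jsub"
      by (rule lat_ring.genideal_minimal[OF ideal_Jsub])
  qed
  also have "\<dots> = Jtilde <+>\<^bsub>lat_ring\<^esub> ?B"
    by (intro lat_ring.union_genideal ideal_Jtilde lat_ring.genideal_ideal) simp
  finally show ?thesis .
qed

lemma Vtilde_bot_eq: "Vtilde_bot = (\<lambda>f. Jtilde +>\<^bsub>lat_ring\<^esub> f) ` Jsub"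
  using ideal.genideal_image_a_rcos[OF ideal_Jtilde, of "{frag_of Orderings.bot}"]
  by (simp add: Vtilde_bot_def Vtilde_def Jsub_eq_Jtilde_add_genideal_bot)

theorem mainTheorem8:
  shows "(Jsub :: ('a::bounded_lattice \<Rightarrow>\<^sub>0 int) set) =
           Jtilde <+>\<^bsub>lat_ring\<^esub> genideal lat_ring {frag_of Orderings.bot} \<and>
         ideal (Jsub :: ('a \<Rightarrow>\<^sub>0 int) set) lat_ring \<and>
         (\<exists>h :: ('a \<Rightarrow>\<^sub>0 int) set set \<Rightarrow> ('a \<Rightarrow>\<^sub>0 int) set.
            h \<in> iso (add_monoid (Vtilde Quot Vtilde_bot)) Mgroup \<and>
            h \<in> ring_iso (Vtilde Quot Vtilde_bot) (lat_ring Quot Jsub) \<and>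
            (\<forall>f. h (Vtilde_bot +>\<^bsub>Vtilde\<^esub> (Jtilde +>\<^bsub>lat_ring\<^esub> f)) = Jsub +>\<^bsub>lat_ring\<^esub> f))"
proof (intro conjI exI allI)
  interpret Jtilde: ideal Jtilde lat_ring
    by (rule ideal_Jtilde)
  show "Jsub = Jtilde <+>\<^bsub>lat_ring\<^esub> genideal lat_ring {frag_of (Orderings.bot :: 'a)}"
    by (rule Jsub_eq_Jtilde_add_genideal_bot)
  show "ideal (Jsub :: ('a \<Rightarrow>\<^sub>0 int) set) lat_ring"
    by (rule ideal_Jsub)
  show ring_iso: "\<Union> \<in> ring_iso (Vtilde Quot Vtilde_bot) (lat_ring Quot (Jsub :: ('a \<Rightarrow>\<^sub>0 int) set))"
    unfolding Vtilde_def Vtilde_bot_eq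
    by (rule Jtilde.Union_quot_quot_ring_iso[OF ideal_Jsub Jtilde_subset_Jsub])
  show "\<Union> \<in> iso (add_monoid (Vtilde Quot Vtilde_bot)) (Mgroup :: ('a \<Rightarrow>\<^sub>0 int) set monoid)"
    using ring_iso_imp_add_iso[OF ring_iso] unfolding add_monoid_Quot[of lat_ring] Mgroup_def .
  show "\<Union> (Vtilde_bot +>\<^bsub>Vtilde\<^esub> (Jtilde +>\<^bsub>lat_ring\<^esub> f)) = Jsub +>\<^bsub>lat_ring\<^esub> f" for f :: "'a \<Rightarrow>\<^sub>0 int"
    unfolding Vtilde_def Vtilde_bot_eq
    using Jtilde.Union_image_a_rcos[OF ideal_Jsub Jtilde_subset_Jsub, of f]
    by (simp add: Jtilde.rcos_image_a_rcos)
qed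

end
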